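(* Let $\Phi=\{\varphi_i\}_{i=1}^M$ be a frame for $\mathcal{H}_N$. With the Frobenius norm, the set of optimal scalings $$\mathcal{O}_{\Phi}=\Big\{(c_i')_{i=1}^M : c_i'\ge 0 \text{ for all } i,\ \Big\|I_N-\sum_{i=1}^M c_i'\varphi_i\varphi_i^*\Big\|_F=\min_{c_1,\dots,c_M\ge 0}\Big\|I_N-\sum_{i=1}^M c_i\varphi_i\varphi_i^*\Big\|_F\Big\}$$ is a polytope. Moreover, $\mathcal{O}_{\Phi}$ is the convex hull of the minimal optimal scalings, i.e., the vertices of $\mathcal{O}_\Phi$ are the minimal optimal scalings.
   Context: $\mathcal{H}_N$ is an $N$-dimensional (real or complex) Hilbert space, identified with coordinate space so that vectors are columns and $\varphi^*$ is the (conjugate) transpose. A frame for $\mathcal{H}_N$ is a finite family $\{\varphi_i\}_{i=1}^M$ for which there are constants $0<A\le B<\infty$ with $A\|x\|^2\le\sum_{i=1}^M|\langle x,\varphi_i\rangle|^2\le B\|x\|^2$ for all $x\in\mathcal{H}_N$ (equivalently, a spanning family). $I_N$ is the identity matrix and $\|\cdot\|_F$ the Frobenius norm. The optimal operator $T_\Phi$ is the unique element of the closed convex cone $\{\sum_{i=1}^M c_i\varphi_i\varphi_i^*: c_i\ge0\}$ closest to $I_N$ in Frobenius norm, so $\sum_i c_i'\varphi_i\varphi_i^*=T_\Phi$ for every $(c_i')\in\mathcal{O}_\Phi$. An optimal scaling $(c_i')_{i=1}^M\in\mathcal{O}_\Phi$ is called a minimal optimal scaling if no proper subfamily of $\{\varphi_i\varphi_i^*: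 c_i'>0\}$ (indexed by $i$) can span $T_\Phi$ with nonnegative coefficients, i.e. there is no proper subset $J\subsetneq\{i:c_i'>0\}$ and coefficients $x_i\ge0$ $(i\in J)$ with $\sum_{i\in J}x_i\varphi_i\varphi_i^*=T_\Phi$.
   Formalization: All frame vectors are additionally assumed nonzero (and N ≥ 1): if some frame vector is zero, its coefficient is arbitrary, so the set of optimal scalings is unbounded and is not a polytope, e.g. for the frame {1, 0} of the one-dimensional space. *)

theory Defs
  imports "HOL-Analysis.Analysis" "Jordan_Normal_Form.Conjugate"
begin

text \<open>
  The scalar type \<open>'k\<close> is meant to be \<open>real\<close> or \<open>complex\<close>; the constant \<open>conjugate\<close> is the identity
  on \<open>real\<close> and \<open>cnj\<close> on \<open>complex\<close>. A family of \<open>M\<close> vectors in an \<open>N\<close>-dimensional space is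
  a function from a finite type with \<open>M\<close> elements to \<open>'k ^ 'n\<close>, where \<open>'n\<close> has \<open>N\<close> elements.
\<close>

definition hermitian_inner ::
    "'k::{conjugatable_field, real_normed_field} ^ 'n \<Rightarrow> 'k ^ 'n \<Rightarrow> 'k" where
  "hermitian_inner x y = (\<Sum>j\<in>UNIV. x $ j * conjugate (y $ j))"

definition is_frame ::
    "('m::finite \<Rightarrow> 'k::{conjugatable_field, real_normed_field} ^ 'n) \<Rightarrow> bool" where
  "is_frame \<Phi> \<longleftrightarrow>
     (\<exists>A B. 0 < A \<and> A \<le> B \<and>
        (\<forall>x. A * (norm x)\<^sup>2 \<le> (\<Sum>i\<in>UNIV. (norm (hermitian_inner x (\<Phi> i)))\<^sup>2) \<and>
             (\<Sum>i\<in>UNIV. (norm (hermitian_inner x (\<Phi> i)))\<^sup>2) \<le> B * (norm x)\<^sup>2))"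

text \<open>The rank-one matrix \<open>v v\<^sup>*\<close>.\<close>

definition outer_square ::
    "'k::{conjugatable_field, real_normed_field} ^ 'n \<Rightarrow> 'k ^ 'n ^ 'n" where
  "outer_square v = (\<chi> i j. v $ i * conjugate (v $ j))"

definition scaled_operator ::
    "('m::finite \<Rightarrow> 'k::{conjugatable_field, real_normed_field} ^ 'n) \<Rightarrow> real ^ 'm \<Rightarrow> 'k ^ 'n ^ 'n" where
  "scaled_operator \<Phi> c = (\<Sum>i\<in>UNIV. (c $ i) *\<^sub>R outer_square (\<Phi> i))"

text \<open>The library norm on \<open>'k ^ 'n ^ 'n\<close> is the Frobenius norm, and \<open>dist\<close> is the Frobenius distance.\<close>

lemma norm_eq_frobenius:
  fixes A :: "'k::real_normed_field ^ 'n ^ 'm"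
  shows "norm A = sqrt (\<Sum>i\<in>UNIV. \<Sum>j\<in>UNIV. (norm (A $ i $ j))\<^sup>2)"
  by (simp add: norm_vec_def L2_set_def sum_nonneg)

definition optimal_scalings ::
    "('m::finite \<Rightarrow> 'k::{conjugatable_field, real_normed_field} ^ 'n) \<Rightarrow> (real ^ 'm) set" where
  "optimal_scalings \<Phi> =
     {c. (\<forall>i. 0 \<le> c $ i) \<and>
         (\<forall>d. (\<forall>i. 0 \<le> d $ i) \<longrightarrow>
            norm (mat 1 - scaled_operator \<Phi> c) \<le> norm (mat 1 - scaled_operator \<Phi> d))}"

definition frame_cone ::
    "('m::finite \<Rightarrow> 'k::{conjugatable_field, real_normed_field} ^ 'n) \<Rightarrow> ('k ^ 'n ^ 'n) set" where
  "frame_cone \<Phi> = {scaled_operator \<Phi> c | c. \<forall>i. 0 \<le> c $ i}"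

definition optimal_operator ::
    "('m::finite \<Rightarrow> 'k::{conjugatable_field, real_normed_field, real_inner, heine_borel} ^ 'n)
      \<Rightarrow> 'k ^ 'n ^ 'n" where
  "optimal_operator \<Phi> = closest_point (frame_cone \<Phi>) (mat 1)"

definition minimal_optimal_scaling ::
    "('m::finite \<Rightarrow> 'k::{conjugatable_field, real_normed_field, real_inner, heine_borel} ^ 'n)
      \<Rightarrow> real ^ 'm \<Rightarrow> bool" where
  "minimal_optimal_scaling \<Phi> c \<longleftrightarrow>
     c \<in> optimal_scalings \<Phi> \<and>
     \<not> (\<exists>J (x :: 'm \<Rightarrow> real). J \<subset> {i. 0 < c $ i} \<and> (\<forall>i\<in>J. 0 \<le> x i) \<and>
            (\<Sum>i\<in>J. x i *\<^sub>R outer_square (\<Phi> i)) = optimal_operator \<Phi>)"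

text \<open>
  A zero vector in the family makes the set of optimal scalings contain a ray, so that it is
  unbounded and not a polytope. Frame vectors therefore have to be assumed nonzero.
\<close>

lemma optimal_scalings_ray:
  fixes \<Phi> :: "'m::finite \<Rightarrow> 'k::{conjugatable_field, real_normed_field} ^ 'n"
  assumes "\<Phi> k = 0" "c \<in> optimal_scalings \<Phi>" "0 \<le> t"
  shows "c + t *\<^sub>R axis k 1 \<in> optimal_scalings \<Phi>"
proof -
  have "outer_square (\<Phi> k) = 0"
    using assms(1) by (simp add: outer_square_def vec_eq_iff)
  then have "((c + t *\<^sub>R axis k 1) $ i) *\<^sub>R outer_square (\<Phi> i) = (c $ i) *\<^sub>R outer_square (\<Phi> i)" for i
    by (cases "i = k") (simp_all add: axis_def)
  then have "scaled_operator \<Phi> (c + t *\<^sub>R axis k 1) = scaled_operator \<Phi> c"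
    by (simp only: scaled_operator_def)
  then show ?thesis
    using assms(2,3) by (auto simp: optimal_scalings_def axis_def)
qed

end

theory Submission
  imports Defs
begin

text \<open>
  The cone of frame operators is finitely generated, hence closed and convex, so the identity has
  a unique nearest point \<open>T\<close> in it, and the optimal scalings are exactly the solutions \<open>c \<ge> 0\<close> of
  the linear system \<open>\<Sum>\<^sub>i c\<^sub>i \<phi>\<^sub>i \<phi>\<^sub>i\<^sup>* = T\<close>. Taking the inner product with the identity, i.e. taking
  traces, gives \<open>\<Sum>\<^sub>i c\<^sub>i \<parallel>\<phi>\<^sub>i\<parallel>\<^sup>2 = trace T\<close>. As the frame vectors are nonzero, this bounds every
  coefficient, so the solution set is a box cut by an affine subspace, which is a polytope and
  therefore the convex hull of its vertices.

  What remains is to see that the vertices are the solutions of minimal support. If \<open>a\<close> and \<open>c\<close>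
  are different solutions and the support of \<open>a\<close> lies in that of \<open>c\<close>, subtract the largest
  multiple \<open>t a\<close> that keeps \<open>c - t a\<close> nonnegative. The trace identity forces \<open>t < 1\<close>, so
  rescaling the remainder writes \<open>c\<close> as a proper convex combination of \<open>a\<close> and of a
  third solution whose support is strictly smaller than that of \<open>c\<close> (lemma
  \<open>nonneg_fibre_peel\<close>). Consequently \<open>c\<close> fails to be a vertex, and also
  fails to have minimal support, precisely when another solution is supported inside the
  support of \<open>c\<close>.

  This argument uses of the rank-one matrices only that they have positive inner product with one
  fixed vector, so it is carried out for the fibre of a linear map over the nonnegative orthant,
  and the real and complex cases are both instances.
\<close>

section \<open>Fibres of a linear map over the nonnegative orthant\<close>

definition nonneg_fibre :: "(real ^ 'm \<Rightarrow> 'v) \<Rightarrow> 'v \<Rightarrow> (real ^ 'm) set" where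
  "nonneg_fibre f T = {c. (\<forall>i. 0 \<le> c $ i) \<and> f c = T}"

definition vec_support :: "real ^ 'm \<Rightarrow> 'm set" where
  "vec_support c = {i. 0 < c $ i}"

lemma nonneg_eq_0_outside_support:
  assumes "\<And>i. 0 \<le> c $ i" "i \<notin> vec_support c"
  shows "c $ i = 0"
  using assms(1)[of i] assms(2) by (simp add: vec_support_def)

lemma inner_linear_orthant:
  fixes f :: "real ^ 'm::finite \<Rightarrow> 'v::real_inner"
  assumes "linear f"
  shows "b \<bullet> f c = (\<Sum>i\<in>UNIV. c $ i * (b \<bullet> f (axis i 1)))"
proof -
  have "f c = f (\<Sum>i\<in>UNIV. (c $ i) *\<^sub>R axis i 1)"
    using basis_expansion[of c] by (simp add: scalar_mult_eq_scaleR)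
  also have "\<dots> = (\<Sum>i\<in>UNIV. (c $ i) *\<^sub>R f (axis i 1))"
    using assms by (simp add: linear_sum linear_scale)
  finally show ?thesis
    by (simp add: inner_sum_right)
qed

text \<open>
  Two solutions have the same weighted sum of coefficients, with positive weights
  \<open>b \<bullet> f (axis i 1)\<close>, so one cannot dominate the other.
\<close>

lemma nonneg_fibre_dominated_eq:
  fixes f :: "real ^ 'm::finite \<Rightarrow> 'v::real_inner"
  assumes "linear f" and pos: "\<And>i. 0 < b \<bullet> f (axis i 1)"
    and "f a = f c" and le: "\<And>i. a $ i \<le> c $ i"
  shows "a = c"
proof -
  have "(\<Sum>i\<in>UNIV. (c $ i - a $ i) * (b \<bullet> f (axis i 1))) = b \<bullet> f c - b \<bullet> f a"
    using inner_linear_orthant[OF assms(1), of b a] inner_linear_orthant[OF assms(1), of b c]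
    by (simp add: left_diff_distrib sum_subtractf)
  also have "\<dots> = 0"
    using assms(3) by simp
  finally have "(c $ i - a $ i) * (b \<bullet> f (axis i 1)) = 0" for i
    using le pos by (subst (asm) sum_nonneg_eq_0_iff) (auto simp: less_imp_le)
  moreover have "b \<bullet> f (axis i 1) \<noteq> 0" for i
    using pos[of i] by simp
  ultimately show ?thesis
    by (simp add: vec_eq_iff)
qed

lemma nonneg_fibre_eq_affine_Int_box:
  fixes f :: "real ^ 'm::finite \<Rightarrow> 'v::real_inner"
  assumes "linear f" and pos: "\<And>i. 0 < b \<bullet> f (axis i 1)"
  shows "nonneg_fibre f T = cbox 0 (\<chi> i. b \<bullet> T / (b \<bullet> f (axis i 1))) \<inter> {c. f c = T}"
proof -
  have "c $ i \<le> b \<bullet> T / (b \<bullet> f (axis i 1))" if "\<And>i. 0 \<le> c $ i" "f c = T" for c i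
  proof -
    have "c $ i * (b \<bullet> f (axis i 1)) \<le> (\<Sum>i\<in>UNIV. c $ i * (b \<bullet> f (axis i 1)))"
      using that(1) pos by (intro member_le_sum) (auto simp: less_imp_le)
    also have "\<dots> = b \<bullet> T"
      using that(2) inner_linear_orthant[OF assms(1), of b c] by simp
    finally show ?thesis
      using pos by (simp add: pos_le_divide_eq)
  qed
  then show ?thesis
    by (auto simp: nonneg_fibre_def mem_box_cart)
qed

lemma polytope_nonneg_fibre:
  fixes f :: "real ^ 'm::finite \<Rightarrow> 'v::real_inner"
  assumes "linear f" and "\<And>i. 0 < b \<bullet> f (axis i 1)"
  shows "polytope (nonneg_fibre f T)"
proof -
  have "affine {c. f c = T}"
    using assms(1) by (auto simp: affine_def linear_add linear_scale simp flip: scaleR_left_distrib)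
  then show ?thesis
    unfolding nonneg_fibre_eq_affine_Int_box[OF assms]
    by (intro polytope_Int_polyhedron polytope_interval affine_imp_polyhedron)
qed

text \<open>
  The ratio test of the simplex method: the largest multiple of \<open>a\<close> that can be subtracted from
  \<open>c\<close> is the least quotient \<open>c\<^sub>i / a\<^sub>i\<close>, and a coordinate attaining it is annihilated.
\<close>

lemma ratio_test:
  fixes a c :: "real ^ 'm::finite"
  assumes "\<And>i. 0 \<le> a $ i" "\<And>i. 0 \<le> c $ i"
    and "vec_support a \<subseteq> vec_support c" and ne: "vec_support a \<noteq> {}"
  obtains t k where "0 < t" "\<And>i. t * a $ i \<le> c $ i" "k \<in> vec_support c" "t * a $ k = c $ k"
proof -
  define R where "R = (\<lambda>i. c $ i / a $ i) ` vec_support a"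
  have "Min R \<in> R"
    using ne by (intro Min_in) (auto simp: R_def)
  then obtain k where k: "k \<in> vec_support a" "Min R = c $ k / a $ k"
    by (auto simp: R_def)
  show thesis
  proof
    show "k \<in> vec_support c"
      using k assms(3) by auto
    then show "0 < Min R"
      using k by (simp add: vec_support_def)
    show "Min R * a $ k = c $ k"
      using k by (simp add: vec_support_def)
    show "Min R * a $ i \<le> c $ i" for i
    proof (cases "i \<in> vec_support a")
      case True
      then have "Min R \<le> c $ i / a $ i"
        by (auto simp: R_def)
      then show ?thesis
        using True by (simp add: vec_support_def pos_le_divide_eq)
    next
      case False
      then show ?thesis
        using assms(2)[of i] nonneg_eq_0_outside_support[OF assms(1)] by simp
    qed
  qed
qed

text \<open>
  The multiplier \<open>t\<close> from the ratio test is below one because \<open>c\<close> cannot dominate the different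
  solution \<open>a\<close>. Hence \<open>c - t a\<close> lies over \<open>(1 - t) T\<close> and can be rescaled back to a solution.
\<close>

lemma nonneg_fibre_peel:
  fixes f :: "real ^ 'm::finite \<Rightarrow> 'v::real_inner"
  assumes "linear f" and pos: "\<And>i. 0 < b \<bullet> f (axis i 1)"
    and a: "a \<in> nonneg_fibre f T" and c: "c \<in> nonneg_fibre f T"
    and sub: "vec_support a \<subseteq> vec_support c" and "a \<noteq> c"
  obtains e where "e \<in> nonneg_fibre f T" "c \<in> open_segment a e" "vec_support e \<subset> vec_support c"
proof -
  have nn: "\<And>i. 0 \<le> a $ i" "\<And>i. 0 \<le> c $ i" and eq: "f a = T" "f c = T"
    using a c by (auto simp: nonneg_fibre_def)
  have not_le: "\<not> (\<forall>i. a $ i \<le> c $ i)"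
    using nonneg_fibre_dominated_eq[OF assms(1) pos, of a c] eq \<open>a \<noteq> c\<close> by auto
  have "vec_support a \<noteq> {}"
    using not_le nn nonneg_eq_0_outside_support[OF nn(1)] by auto
  then obtain t k where t: "0 < t" "\<And>i. t * a $ i \<le> c $ i"
    and k: "k \<in> vec_support c" "t * a $ k = c $ k"
    using ratio_test[OF nn sub] by blast
  have "t < 1"
  proof (rule ccontr)
    assume "\<not> t < 1"
    then have "a $ i \<le> c $ i" for i
      using t(2)[of i] mult_right_mono[of 1 t "a $ i"] nn(1)[of i] by simp
    then show False
      using not_le by blast
  qed
  define e where "e = (1 / (1 - t)) *\<^sub>R (c - t *\<^sub>R a)"
  have e_nth: "e $ i = (c $ i - t * a $ i) / (1 - t)" for i
    by (simp add: e_def)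
  have c_eq: "c = (1 - t) *\<^sub>R e + t *\<^sub>R a"
    using \<open>t < 1\<close> by (simp add: e_def)
  have "f e = (1 / (1 - t)) *\<^sub>R ((1 - t) *\<^sub>R T)"
    using assms(1) eq by (simp add: e_def linear_scale linear_diff scaleR_left_diff_distrib)
  then have "e \<in> nonneg_fibre f T"
    using \<open>t < 1\<close> t(2) by (simp add: nonneg_fibre_def e_nth)
  moreover have "c \<in> open_segment a e"
  proof -
    have "a \<noteq> e"
      using c_eq \<open>a \<noteq> c\<close> by (auto simp flip: scaleR_left_distrib)
    then have "c \<in> open_segment e a"
      using c_eq t(1) \<open>t < 1\<close> by (auto simp: in_segment)
    then show ?thesis
      by (simp add: open_segment_commute)
  qed
  moreover have "vec_support e \<subset> vec_support c"
  proof
    show "vec_support e \<subseteq> vec_support c"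
    proof
      fix i
      assume "i \<in> vec_support e"
      then have "t * a $ i < c $ i"
        using \<open>t < 1\<close> by (simp add: vec_support_def e_nth zero_less_divide_iff)
      moreover have "0 \<le> t * a $ i"
        using t(1) nn(1) by simp
      ultimately show "i \<in> vec_support c"
        unfolding vec_support_def by simp
    qed
    have "k \<notin> vec_support e"
      using k(2) by (simp add: vec_support_def e_nth)
    then show "vec_support e \<noteq> vec_support c"
      using k(1) by blast
  qed
  ultimately show thesis
    using that by blast
qed

lemma vec_support_subset_of_open_segment:
  assumes "c \<in> open_segment a d" "\<And>i. 0 \<le> a $ i" "\<And>i. 0 \<le> d $ i"
  shows "vec_support a \<subseteq> vec_support c"
proof
  fix i
  assume i: "i \<in> vec_support a"
  obtain u where "0 < u" "u < 1" "c = (1 - u) *\<^sub>R a + u *\<^sub>R d"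
    using assms(1) by (auto simp: in_segment)
  then show "i \<in> vec_support c"
    using i assms(3)[of i] by (auto simp: vec_support_def intro!: add_pos_nonneg)
qed

text \<open>
  Both properties say that no other solution is supported inside the support of \<open>c\<close>: the
  end points of a segment of solutions around \<open>c\<close> are such solutions, and conversely peeling one off destroys
  extremality and minimality at once.
\<close>

lemma extreme_point_nonneg_fibre_iff:
  fixes f :: "real ^ 'm::finite \<Rightarrow> 'v::real_inner"
  assumes "linear f" and pos: "\<And>i. 0 < b \<bullet> f (axis i 1)"
  shows "c extreme_point_of nonneg_fibre f T \<longleftrightarrow>
    c \<in> nonneg_fibre f T \<and> \<not> (\<exists>d\<in>nonneg_fibre f T. vec_support d \<subset> vec_support c)"
    (is "?extreme \<longleftrightarrow> ?minimal")
proof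
  assume extreme: ?extreme
  then have c: "c \<in> nonneg_fibre f T"
    by (simp add: extreme_point_of_def)
  moreover have False if d: "d \<in> nonneg_fibre f T" "vec_support d \<subset> vec_support c" for d
  proof -
    obtain e where "e \<in> nonneg_fibre f T" "c \<in> open_segment d e"
      using nonneg_fibre_peel[OF assms d(1) c] d(2) by blast
    then show False
      using extreme d(1) by (auto simp: extreme_point_of_def)
  qed
  ultimately show ?minimal
    by blast
next
  assume minimal: ?minimal
  have "c \<notin> open_segment a d" if a: "a \<in> nonneg_fibre f T" and d: "d \<in> nonneg_fibre f T" for a d
  proof
    assume seg: "c \<in> open_segment a d"
    have sub: "vec_support a \<subseteq> vec_support c"
      using vec_support_subset_of_open_segment[OF seg] a d by (simp add: nonneg_fibre_def)
    have "a \<noteq> c"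
      using seg by (auto simp: open_segment_def)
    moreover have "c \<in> nonneg_fibre f T"
      using minimal by blast
    ultimately obtain e where "e \<in> nonneg_fibre f T" "vec_support e \<subset> vec_support c"
      using nonneg_fibre_peel[OF assms a _ sub] by metis
    then show False
      using minimal by blast
  qed
  then show ?extreme
    using minimal by (simp add: extreme_point_of_def)
qed

section \<open>The image of the nonnegative orthant\<close>

text \<open>
  The image is a finitely generated cone, for which closedness is a genuine theorem: linear
  images of closed cones need not be closed in general.
\<close>

lemma closed_convex_linear_image_orthant:
  fixes f :: "real ^ 'm::finite \<Rightarrow> 'v::euclidean_space"
  assumes "linear f"
  shows "closed (f ` {c. \<forall>i. 0 \<le> c $ i})" "convex (f ` {c. \<forall>i. 0 \<le> c $ i})"
proof -
  define X :: "(real ^ 'm) set" where "X = range (\<lambda>i. axis i 1)"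
  have "c \<in> convex_cone hull X" if "\<forall>i. 0 \<le> c $ i" for c
  proof -
    have "(\<Sum>i\<in>I. (c $ i) *\<^sub>R axis i 1) \<in> convex_cone hull X" if "finite I" for I
      using \<open>finite I\<close>
    proof (induction I rule: finite_induct)
      case empty
      then show ?case
        by (simp add: convex_cone_hull_contains_0)
    next
      case (insert i I)
      have "(c $ i) *\<^sub>R axis i 1 \<in> convex_cone hull X"
        using \<open>\<forall>i. 0 \<le> c $ i\<close> by (intro convex_cone_hull_mul) (auto simp: X_def intro: hull_inc)
      then show ?case
        using insert by (simp add: convex_cone_hull_add)
    qed
    from this[of UNIV] show ?thesis
      using basis_expansion[of c] by (simp add: scalar_mult_eq_scaleR)
  qed
  moreover have "convex_cone hull X \<subseteq> {c. \<forall>i. 0 \<le> c $ i}"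
    by (rule hull_minimal) (auto simp: X_def axis_def convex_cone_iff)
  ultimately have "{c. \<forall>i. 0 \<le> c $ i} = convex_cone hull X"
    by blast
  then have "f ` {c. \<forall>i. 0 \<le> c $ i} = convex_cone hull (f ` X)"
    using assms by (simp add: convex_cone_hull_linear_image)
  then show "closed (f ` {c. \<forall>i. 0 \<le> c $ i})" "convex (f ` {c. \<forall>i. 0 \<le> c $ i})"
    by (simp_all add: X_def closed_convex_cone_hull convex_convex_cone_hull)
qed

section \<open>Optimal scalings of a frame\<close>

lemma linear_scaled_operator: "linear (scaled_operator \<Phi>)"
  by (auto intro!: linearI
      simp: scaled_operator_def scaleR_left_distrib sum.distrib scaleR_sum_right)

lemma scaled_operator_axis: "scaled_operator \<Phi> (axis k 1) = outer_square (\<Phi> k)"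
proof -
  have "(\<Sum>i\<in>UNIV. (axis k 1 $ i) *\<^sub>R outer_square (\<Phi> i)) =
      (\<Sum>i\<in>UNIV. if i = k then outer_square (\<Phi> i) else 0)"
    by (rule sum.cong) (auto simp: axis_def)
  then show ?thesis
    by (simp add: scaled_operator_def)
qed

text \<open>
  The inner product with the identity is the real part of the trace, which for \<open>v v\<^sup>*\<close> is
  \<open>\<parallel>v\<parallel>\<^sup>2\<close>. The hypothesis is the positivity of \<open>z z\<^sup>*\<close> for scalars, in a form common to
  \<open>real\<close> and \<open>complex\<close>.
\<close>

lemma inner_mat_1_outer_square_pos:
  fixes v :: "'k::{conjugatable_field, real_normed_field, euclidean_space} ^ 'n"
  assumes conj: "\<And>z::'k. z \<noteq> 0 \<Longrightarrow> 0 < 1 \<bullet> (z * conjugate z)" and "v \<noteq> 0"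
  shows "0 < mat 1 \<bullet> outer_square v"
proof -
  have "mat 1 \<bullet> outer_square v =
      (\<Sum>i\<in>UNIV. \<Sum>j\<in>UNIV. (if i = j then 1 else 0) \<bullet> (v $ i * conjugate (v $ j)))"
    by (simp add: inner_vec_def mat_def outer_square_def)
  also have "\<dots> = (\<Sum>i\<in>UNIV. \<Sum>j\<in>UNIV. if j = i then 1 \<bullet> (v $ i * conjugate (v $ j)) else 0)"
    by (intro sum.cong) auto
  also have "\<dots> = (\<Sum>i\<in>UNIV. 1 \<bullet> (v $ i * conjugate (v $ i)))"
    by simp
  finally have eq: "mat 1 \<bullet> outer_square v = (\<Sum>i\<in>UNIV. 1 \<bullet> (v $ i * conjugate (v $ i)))" .
  obtain k where "v $ k \<noteq> 0"
    using \<open>v \<noteq> 0\<close> by (auto simp: vec_eq_iff)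
  moreover have "0 \<le> 1 \<bullet> (v $ i * conjugate (v $ i))" for i
    using conj[of "v $ i"] by (cases "v $ i = 0") auto
  ultimately show ?thesis
    unfolding eq by (intro sum_pos2[where i = k] conj) auto
qed

lemma frame_cone_eq_image: "frame_cone \<Phi> = scaled_operator \<Phi> ` {c. \<forall>i. 0 \<le> c $ i}"
  by (auto simp: frame_cone_def)

text \<open>By uniqueness of the nearest point, being optimal is a linear equation for \<open>c \<ge> 0\<close>.\<close>

lemma optimal_scalings_eq_nonneg_fibre:
  fixes \<Phi> :: "'m::finite \<Rightarrow> 'k::{conjugatable_field, real_normed_field, euclidean_space} ^ 'n"
  shows "optimal_scalings \<Phi> = nonneg_fibre (scaled_operator \<Phi>) (optimal_operator \<Phi>)"
proof -
  let ?K = "frame_cone \<Phi>"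
  have K: "closed ?K" "convex ?K"
    using closed_convex_linear_image_orthant[OF linear_scaled_operator, of \<Phi>]
    by (simp_all add: frame_cone_eq_image)
  have "?K \<noteq> {}"
    by (auto simp: frame_cone_def intro: exI[of _ 0])
  then have closest: "\<forall>y\<in>?K. dist (mat 1) (optimal_operator \<Phi>) \<le> dist (mat 1) y"
    using closest_point_exists(2)[OF K(1)] by (simp add: optimal_operator_def)
  have "scaled_operator \<Phi> c = optimal_operator \<Phi> \<longleftrightarrow>
      (\<forall>d. (\<forall>i. 0 \<le> d $ i) \<longrightarrow>
        norm (mat 1 - scaled_operator \<Phi> c) \<le> norm (mat 1 - scaled_operator \<Phi> d))"
    (is "_ \<longleftrightarrow> ?opt") if "\<forall>i. 0 \<le> c $ i" for c
  proof
    assume "scaled_operator \<Phi> c = optimal_operator \<Phi>"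
    then show ?opt
      using closest by (auto simp: frame_cone_def dist_norm)
  next
    assume ?opt
    then have "\<forall>y\<in>?K. dist (mat 1) (scaled_operator \<Phi> c) \<le> dist (mat 1) y"
      by (auto simp: frame_cone_def dist_norm)
    moreover have "scaled_operator \<Phi> c \<in> ?K"
      using that by (auto simp: frame_cone_def)
    ultimately show "scaled_operator \<Phi> c = optimal_operator \<Phi>"
      unfolding optimal_operator_def using closest_point_unique[OF K(2) K(1)] by blast
  qed
  then show ?thesis
    by (auto simp: optimal_scalings_def nonneg_fibre_def)
qed

text \<open>
  A nonnegative representation of \<open>T\<close> by a subfamily becomes, after extension by zero, a solution
  whose support lies in the index set of that subfamily.
\<close>

lemma minimal_optimal_scaling_iff_support_minimal:
  fixes \<Phi> :: "'m::finite \<Rightarrow> 'k::{conjugatable_field, real_normed_field, euclidean_space} ^ 'n"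
  defines "O\<^sub>\<Phi> \<equiv> nonneg_fibre (scaled_operator \<Phi>) (optimal_operator \<Phi>)"
  shows "minimal_optimal_scaling \<Phi> c \<longleftrightarrow>
    c \<in> O\<^sub>\<Phi> \<and> \<not> (\<exists>d\<in>O\<^sub>\<Phi>. vec_support d \<subset> vec_support c)"
proof -
  have "(\<exists>J x. J \<subset> {i. 0 < c $ i} \<and> (\<forall>i\<in>J. 0 \<le> x i) \<and>
            (\<Sum>i\<in>J. x i *\<^sub>R outer_square (\<Phi> i)) = optimal_operator \<Phi>)
        \<longleftrightarrow> (\<exists>d\<in>O\<^sub>\<Phi>. vec_support d \<subset> vec_support c)" (is "?L \<longleftrightarrow> ?R")
  proof
    assume ?L
    then obtain J and x :: "'m \<Rightarrow> real" where J: "J \<subset> vec_support c" "\<forall>i\<in>J. 0 \<le> x i"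
      and x: "(\<Sum>i\<in>J. x i *\<^sub>R outer_square (\<Phi> i)) = optimal_operator \<Phi>"
      by (auto simp: vec_support_def)
    define d :: "real ^ 'm" where "d = (\<chi> i. if i \<in> J then x i else 0)"
    have "scaled_operator \<Phi> d =
        (\<Sum>i\<in>UNIV. if i \<in> J then x i *\<^sub>R outer_square (\<Phi> i) else 0)"
      unfolding scaled_operator_def by (rule sum.cong) (auto simp: d_def)
    also have "\<dots> = optimal_operator \<Phi>"
      using x by (simp add: sum.If_cases)
    finally have "d \<in> O\<^sub>\<Phi>"
      using J(2) by (simp add: O\<^sub>\<Phi>_def nonneg_fibre_def d_def)
    moreover have "vec_support d \<subseteq> J"
      by (auto simp: vec_support_def d_def split: if_splits)
    ultimately show ?R
      using J(1) by blast
  next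
    assume ?R
    then obtain d where d: "\<And>i. 0 \<le> d $ i" "scaled_operator \<Phi> d = optimal_operator \<Phi>"
      and sub: "vec_support d \<subset> vec_support c"
      by (auto simp: O\<^sub>\<Phi>_def nonneg_fibre_def)
    have "(\<Sum>i\<in>vec_support d. (d $ i) *\<^sub>R outer_square (\<Phi> i)) = scaled_operator \<Phi> d"
      unfolding scaled_operator_def
      by (rule sum.mono_neutral_left) (auto simp: nonneg_eq_0_outside_support[OF d(1)])
    then show ?L
      using d sub by (intro exI[of _ "vec_support d"] exI[of _ "\<lambda>i. d $ i"])
        (auto simp: vec_support_def)
  qed
  then show ?thesis
    unfolding minimal_optimal_scaling_def optimal_scalings_eq_nonneg_fibre O\<^sub>\<Phi>_def by simp
qed

theorem optimal_scalings_polytope_and_vertices: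
  fixes \<Phi> :: "'m::finite \<Rightarrow> 'k::{conjugatable_field, real_normed_field, euclidean_space} ^ 'n"
  assumes conj: "\<And>z::'k. z \<noteq> 0 \<Longrightarrow> 0 < 1 \<bullet> (z * conjugate z)"
    and nz: "\<And>i. \<Phi> i \<noteq> 0"
  shows "polytope (optimal_scalings \<Phi>) \<and>
    optimal_scalings \<Phi> = convex hull {c. minimal_optimal_scaling \<Phi> c} \<and>
    {c. c extreme_point_of optimal_scalings \<Phi>} = {c. minimal_optimal_scaling \<Phi> c}"
proof -
  have pos: "0 < mat 1 \<bullet> scaled_operator \<Phi> (axis i 1)" for i
    using inner_mat_1_outer_square_pos[OF conj nz] by (simp add: scaled_operator_axis)
  have poly: "polytope (optimal_scalings \<Phi>)"
    unfolding optimal_scalings_eq_nonneg_fibre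
    by (rule polytope_nonneg_fibre[OF linear_scaled_operator pos])
  have vertices: "{c. c extreme_point_of optimal_scalings \<Phi>} = {c. minimal_optimal_scaling \<Phi> c}"
    unfolding optimal_scalings_eq_nonneg_fibre minimal_optimal_scaling_iff_support_minimal
    using extreme_point_nonneg_fibre_iff[OF linear_scaled_operator pos] by blast
  have "optimal_scalings \<Phi> = convex hull {c. c extreme_point_of optimal_scalings \<Phi>}"
    using poly by (intro Krein_Milman_Minkowski polytope_imp_compact polytope_imp_convex)
  then show ?thesis
    using poly vertices by simp
qed

theorem theorem19:
  shows "(\<forall>\<Phi> :: 'm::finite \<Rightarrow> real ^ 'n.
            is_frame \<Phi> \<and> (\<forall>i. \<Phi> i \<noteq> 0) \<longrightarrow>
              polytope (optimal_scalings \<Phi>) \<and>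
              optimal_scalings \<Phi> = convex hull {c. minimal_optimal_scaling \<Phi> c} \<and>
              {c. c extreme_point_of optimal_scalings \<Phi>} = {c. minimal_optimal_scaling \<Phi> c}) \<and>
         (\<forall>\<Phi> :: 'm \<Rightarrow> complex ^ 'n.
            is_frame \<Phi> \<and> (\<forall>i. \<Phi> i \<noteq> 0) \<longrightarrow>
              polytope (optimal_scalings \<Phi>) \<and>
              optimal_scalings \<Phi> = convex hull {c. minimal_optimal_scaling \<Phi> c} \<and>
              {c. c extreme_point_of optimal_scalings \<Phi>} = {c. minimal_optimal_scaling \<Phi> c})"
proof -
  have real: "0 < 1 \<bullet> (z * conjugate z)" if "z \<noteq> 0" for z :: real
    using that by (simp add: zero_less_mult_iff neq_iff disj_commute)
  have complex: "0 < 1 \<bullet> (z * conjugate z)" if "z \<noteq> 0" for z :: complex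
    using that by (simp add: inner_complex_def complex_eq_iff sum_power2_gt_zero_iff
        flip: power2_eq_square)
  show ?thesis
    by (intro conjI[of "\<forall>\<Phi> :: 'm \<Rightarrow> real ^ 'n. _ \<Phi>"] allI impI
        optimal_scalings_polytope_and_vertices real complex) simp_all
qed

end
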